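(* Let $\iota_{\rm fake}:\mathcal D{\it if}*\mathcal R_{\rm fake}\hookrightarrow\tilde{\mathcal R}_{\rm fake}$ be the inclusion of differential filtered $\{B,W\}$-colored operads given by $\bar x\mapsto\bar x$, $f_0\mapsto f_0$, $g_0\mapsto g_0$, $f_1\mapsto f_1$, $g_1\mapsto g_1$. There is no retraction of $\iota_{\rm fake}$, i.e. there is no map $r_{\rm fake}:\tilde{\mathcal R}_{\rm fake}\to\mathcal D{\it if}*\mathcal R_{\rm fake}$ of differential filtered colored operads with $r_{\rm fake}\,\iota_{\rm fake}=1$.
   Context: A $\{B,W\}$-colored operad here (only unary operations) is a category with two objects $B,W$ enriched over chain complexes (of abelian groups, differential of degree $-1$); morphisms are enriched functors that are the identity on $\{B,W\}$. The free one $\mathcal F(S)$ on a set $S$ of graded arrows has hom-groups freely spanned by composable words in $S$ (including empty words $1_B,1_W$); $uv$ means $u\circ v$; differentials satisfy $d(uv)=d(u)v+(-1)^{\deg u}u\,d(v)$. A filtered operad has descending filtrations $F^p$, $p\ge0$, of its hom-complexes with $F^pF^q\subset F^{p+q}$; morphisms of filtered operads preserve filtrations. Filtration used on both free operads in what follows: $F^p$ is spanned by the words containing at least $p$ overlined generators (for $\mathcal D{\it if}*\mathcal R_{\rm fake}$ the only overlined generator is $\bar x$; for $\tilde{\mathcal R}_{\rm fake}$ the overlined generators are $\bar x,\bar y,\bar f_0,\bar f_1,\bar g_0,\bar g_1$). In the completion with respect to this filtration, elements of a given degree are formal sums $\sum_{i\ge0}m_i$ with $m_i$ in that degree of the free operad,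 a combination of words with exactly $i$ overlined generators. $\mathcal D{\it if}*\mathcal R_{\rm fake}$ is the completion of $(\mathcal F(\bar x,f_0,g_0,f_1,g_1),d)$ with respect to this filtration, where $\bar x:B\to B$ has degree $-1$, $f_0:B\to W$ and $g_0:W\to B$ have degree $0$, $f_1:B\to B$ and $g_1:W\to W$ have degree $1$, and $$d\bar x=-\bar x\bar x,\quad df_0=dg_0=0,\quad df_1=g_0f_0-1_B,\quad dg_1=f_0g_0-1_W.$$ $\tilde{\mathcal R}_{\rm fake}$ is the completion of $(\mathcal F(\bar x,\bar y,f_0,f_1,g_0,g_1,\bar f_0,\bar f_1,\bar g_0,\bar g_1),d)$ with respect to this filtration, where $\bar x:B\to B$ and $\bar y:W\to W$ have degree $-1$, $f_0,\bar f_0:B\to W$ and $g_0,\bar g_0:W\to B$ have degree $0$, $f_1,\bar f_1:B\to B$ and $g_1,\bar g_1:W\to W$ have degree $1$, and $$d\bar x=-\bar x\bar x,\quad df_0=dg_0=0,\quad df_1=g_0f_0-1_B,\quad dg_1=f_0g_0-1_W,$$ $$d\bar y=-\bar y\bar y,\quad d\bar f_0=f_0\bar x-\bar yf_0+\bar f_0\bar x-\bar y\bar f_0,\quad d\bar g_0=g_0\bar y-\bar xg_0+\bar g_0\bar y-\bar x\bar g_0,$$ $$d\bar f_1=-(\bar xf_1+f_1\bar x)+(\bar g_0f_0+g_0\bar f_0)-(\bar x\bar f_1+\bar f_1\bar x)+\bar g_0\bar f_0,$$ $$d\bar g_1=-(\bar yg_1+g_1\bar y)+(\bar f_0g_0+f_0\bar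 g_0)-(\bar y\bar g_1+\bar g_1\bar y)+\bar f_0\bar g_0.$$ *)

theory Defs
  imports Main
begin

section \<open>Differential filtered two-coloured operads with unary operations\<close>

datatype col = B | W

text \<open>
  \<^term>\<open>Hom P a b n\<close> is the group of operations \<open>a \<rightarrow> b\<close> of degree \<open>n\<close>, given as a subgroup of an
  ambient abelian group; \<^term>\<open>Fil P p a b n\<close> is its \<open>p\<close>-th filtration step, and
  \<^term>\<open>cmp P u v\<close> is \<open>u \<circ> v\<close>.
\<close>

record 'a operad =
  Hom :: "col \<Rightarrow> col \<Rightarrow> int \<Rightarrow> 'a set"
  Fil :: "nat \<Rightarrow> col \<Rightarrow> col \<Rightarrow> int \<Rightarrow> 'a set"
  one :: "col \<Rightarrow> 'a"
  cmp :: "'a \<Rightarrow> 'a \<Rightarrow> 'a"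
  dif :: "'a \<Rightarrow> 'a"

definition sgn_act :: "int \<Rightarrow> 'a::ab_group_add \<Rightarrow> 'a" where
  "sgn_act n u = (if even n then u else - u)"

definition is_subgroup :: "'a::ab_group_add set \<Rightarrow> bool" where
  "is_subgroup A \<longleftrightarrow> 0 \<in> A \<and> (\<forall>u\<in>A. \<forall>v\<in>A. u + v \<in> A) \<and> (\<forall>u\<in>A. - u \<in> A)"

locale df_operad =
  fixes P :: "('a::ab_group_add) operad"
  assumes Hom_subgroup: "is_subgroup (Hom P a b n)"
    and one_Hom: "one P a \<in> Hom P a a 0"
    and cmp_Hom: "\<lbrakk>u \<in> Hom P b c m; v \<in> Hom P a b n\<rbrakk> \<Longrightarrow> cmp P u v \<in> Hom P a c (m + n)"
    and cmp_assoc: "\<lbrakk>t \<in> Hom P c d k; u \<in> Hom P b c m; v \<in> Hom P a b n\<rbrakk>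
        \<Longrightarrow> cmp P (cmp P t u) v = cmp P t (cmp P u v)"
    and one_cmp: "u \<in> Hom P a b n \<Longrightarrow> cmp P (one P b) u = u"
    and cmp_one: "u \<in> Hom P a b n \<Longrightarrow> cmp P u (one P a) = u"
    and cmp_add_left: "\<lbrakk>u \<in> Hom P b c m; u' \<in> Hom P b c m; v \<in> Hom P a b n\<rbrakk>
        \<Longrightarrow> cmp P (u + u') v = cmp P u v + cmp P u' v"
    and cmp_add_right: "\<lbrakk>u \<in> Hom P b c m; v \<in> Hom P a b n; v' \<in> Hom P a b n\<rbrakk>
        \<Longrightarrow> cmp P u (v + v') = cmp P u v + cmp P u v'"
    and dif_Hom: "u \<in> Hom P a b n \<Longrightarrow> dif P u \<in> Hom P a b (n - 1)"
    and dif_add: "\<lbrakk>u \<in> Hom P a b n; v \<in> Hom P a b n\<rbrakk> \<Longrightarrow> dif P (u + v) = dif P u + dif P v"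
    and dif_dif: "u \<in> Hom P a b n \<Longrightarrow> dif P (dif P u) = 0"
    and dif_cmp: "\<lbrakk>u \<in> Hom P b c m; v \<in> Hom P a b n\<rbrakk>
        \<Longrightarrow> dif P (cmp P u v) = cmp P (dif P u) v + sgn_act m (cmp P u (dif P v))"
    and Fil_subgroup: "is_subgroup (Fil P p a b n)"
    and Fil_0: "Fil P 0 a b n = Hom P a b n"
    and Fil_Suc: "Fil P (Suc p) a b n \<subseteq> Fil P p a b n"
    and dif_Fil: "u \<in> Fil P p a b n \<Longrightarrow> dif P u \<in> Fil P p a b (n - 1)"
    and cmp_Fil: "\<lbrakk>u \<in> Fil P p b c m; v \<in> Fil P q a b n\<rbrakk> \<Longrightarrow> cmp P u v \<in> Fil P (p + q) a c (m + n)"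

text \<open>Enriched functors that are the identity on \<^term>\<open>{B, W}\<close>, with components \<open>r a b n\<close> on \<^term>\<open>Hom P a b n\<close>.\<close>

locale df_operad_hom = source: df_operad P + target: df_operad Q
  for P :: "('a::ab_group_add) operad" and Q :: "('b::ab_group_add) operad"
    and r :: "col \<Rightarrow> col \<Rightarrow> int \<Rightarrow> 'a \<Rightarrow> 'b" +
  assumes hom_Hom: "u \<in> Hom P a b n \<Longrightarrow> r a b n u \<in> Hom Q a b n"
    and hom_add: "\<lbrakk>u \<in> Hom P a b n; v \<in> Hom P a b n\<rbrakk> \<Longrightarrow> r a b n (u + v) = r a b n u + r a b n v"
    and hom_one: "r a a 0 (one P a) = one Q a"
    and hom_cmp: "\<lbrakk>u \<in> Hom P b c m; v \<in> Hom P a b n\<rbrakk>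
        \<Longrightarrow> r a c (m + n) (cmp P u v) = cmp Q (r b c m u) (r a b n v)"
    and hom_dif: "u \<in> Hom P a b n \<Longrightarrow> r a b (n - 1) (dif P u) = dif Q (r a b n u)"
    and hom_Fil: "u \<in> Fil P p a b n \<Longrightarrow> r a b n u \<in> Fil Q p a b n"

section \<open>The ring of formal integer series in words\<close>

typedef 'g series = "UNIV :: ('g list \<Rightarrow> int) set"
  morphisms coeff Series ..

setup_lifting type_definition_series

lemma series_eqI: "(\<And>w. coeff u w = coeff v w) \<Longrightarrow> u = v"
  by (metis coeff_inject ext)

definition conv :: "('g list \<Rightarrow> int) \<Rightarrow> ('g list \<Rightarrow> int) \<Rightarrow> 'g list \<Rightarrow> int" where
  "conv u v w = (\<Sum>k\<le>length w. u (take k w) * v (drop k w))"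

lemma conv_Nil: "conv u v [] = u [] * v []"
  by (simp add: conv_def)

lemma conv_Cons: "conv u v (s # w) = u [] * v (s # w) + conv (\<lambda>t. u (s # t)) v w"
  unfolding conv_def by (simp add: sum.atMost_Suc_shift del: sum.atMost_Suc)

lemma conv_add_left: "conv (\<lambda>t. u t + u' t) v w = conv u v w + conv u' v w"
  by (simp add: conv_def algebra_simps sum.distrib)

lemma conv_add_right: "conv u (\<lambda>t. v t + v' t) w = conv u v w + conv u v' w"
  by (simp add: conv_def algebra_simps sum.distrib)

lemma conv_scale_left: "conv (\<lambda>t. c * u t) v w = c * conv u v w"
  by (simp add: conv_def algebra_simps sum_distrib_left)

lemma conv_assoc: "conv (conv u v) z w = conv u (conv v z) w"
proof (induction w arbitrary: u v)
  case Nil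
  then show ?case by (simp add: conv_Nil)
next
  case (Cons s w)
  then show ?case
    by (simp add: conv_Cons conv_Nil conv_add_left conv_scale_left algebra_simps)
qed

lemma conv_zero_left: "conv (\<lambda>t. 0) v w = 0"
  by (simp add: conv_def)

lemma conv_one_left: "conv (\<lambda>t. if t = [] then 1 else 0) v w = v w"
  by (cases w) (simp_all add: conv_Cons conv_Nil conv_zero_left)

lemma conv_one_right: "conv u (\<lambda>t. if t = [] then 1 else 0) w = u w"
  by (induction w arbitrary: u) (simp_all add: conv_Cons conv_Nil)

instantiation series :: (type) ring_1
begin

lift_definition zero_series :: "'a series" is "\<lambda>w. 0" .
lift_definition one_series :: "'a series" is "\<lambda>w. if w = [] then 1 else 0" .
lift_definition plus_series :: "'a series \<Rightarrow> 'a series \<Rightarrow> 'a series" is "\<lambda>u v w. u w + v w" .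
lift_definition minus_series :: "'a series \<Rightarrow> 'a series \<Rightarrow> 'a series" is "\<lambda>u v w. u w - v w" .
lift_definition uminus_series :: "'a series \<Rightarrow> 'a series" is "\<lambda>u w. - u w" .
lift_definition times_series :: "'a series \<Rightarrow> 'a series \<Rightarrow> 'a series" is conv .

instance
proof
  fix a b c :: "'a series"
  show "a * b * c = a * (b * c)" by transfer (simp add: conv_assoc fun_eq_iff)
  show "a + b + c = a + (b + c)" by transfer (simp add: fun_eq_iff)
  show "a + b = b + a" by transfer (simp add: fun_eq_iff)
  show "0 + a = a" by transfer (simp add: fun_eq_iff)
  show "1 * a = a" by transfer (simp add: fun_eq_iff conv_one_left)
  show "a * 1 = a" by transfer (simp add: fun_eq_iff conv_one_right)
  show "- a + a = 0" by transfer (simp add: fun_eq_iff)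
  show "a - b = a + - b" by transfer (simp add: fun_eq_iff)
  show "(a + b) * c = a * c + b * c" by transfer (simp add: fun_eq_iff conv_add_left)
  show "a * (b + c) = a * b + a * c" by transfer (simp add: fun_eq_iff conv_add_right)
  show "(0::'a series) \<noteq> 1" by transfer (auto simp: fun_eq_iff)
qed

end

lemma coeff_0 [simp]: "coeff 0 w = 0" by transfer simp
lemma coeff_1: "coeff 1 w = (if w = [] then 1 else 0)" by transfer simp
lemma coeff_add [simp]: "coeff (u + v) w = coeff u w + coeff v w" by transfer simp
lemma coeff_diff [simp]: "coeff (u - v) w = coeff u w - coeff v w" by transfer simp
lemma coeff_minus [simp]: "coeff (- u) w = - coeff u w" by transfer simp
lemma coeff_mult: "coeff (u * v) w = (\<Sum>k\<le>length w. coeff u (take k w) * coeff v (drop k w))"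
  by transfer (simp add: conv_def)

lift_definition word :: "'g list \<Rightarrow> 'g series" is "\<lambda>w v. if v = w then 1 else 0" .

lemma coeff_word: "coeff (word w) v = (if v = w then 1 else 0)" by transfer simp

lemma word_Nil: "word [] = 1" by transfer simp

lemma coeff_mult_nonzeroE:
  assumes "coeff (u * v) w \<noteq> 0"
  obtains w1 w2 where "w = w1 @ w2" "coeff u w1 \<noteq> 0" "coeff v w2 \<noteq> 0"
proof -
  obtain k where "coeff u (take k w) * coeff v (drop k w) \<noteq> 0"
    using assms unfolding coeff_mult by (meson sum.neutral)
  with that[of "take k w" "drop k w"] show thesis by simp
qed

lemma word_mult_word: "word v * word w = word (v @ w)"
proof -
  have *: "word (s # v) = word [s] * word v" for s :: 'a and v
  proof (rule series_eqI)
    fix t :: "'a list"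
    show "coeff (word (s # v)) t = coeff (word [s] * word v) t"
    proof (cases t)
      case Nil
      then show ?thesis by (simp add: coeff_mult coeff_word)
    next
      case (Cons a t')
      have "conv (\<lambda>t. if a # t = [s] then 1 else 0) (coeff (word v)) t'
          = (if a = s then coeff (word v) t' else 0)"
        using conv_one_left[of "coeff (word v)" t'] by (auto simp: conv_zero_left)
      then show ?thesis
        unfolding Cons times_series.rep_eq conv_Cons by (simp add: coeff_word word.rep_eq)
    qed
  qed
  show ?thesis
  proof (induction v)
    case (Cons s v)
    then show ?case using *[of s v] *[of s "v @ w"] by (simp add: mult.assoc)
  qed (simp add: word_Nil)
qed

section \<open>Generators, gradings and the differential\<close>

datatype gen = Xbar | Ybar | F0 | F1 | G0 | G1 | F0bar | F1bar | G0bar | G1bar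

fun src :: "gen \<Rightarrow> col" where
  "src Xbar = B" | "src Ybar = W"
| "src F0 = B" | "src F0bar = B" | "src G0 = W" | "src G0bar = W"
| "src F1 = B" | "src F1bar = B" | "src G1 = W" | "src G1bar = W"

fun tgt :: "gen \<Rightarrow> col" where
  "tgt Xbar = B" | "tgt Ybar = W"
| "tgt F0 = W" | "tgt F0bar = W" | "tgt G0 = B" | "tgt G0bar = B"
| "tgt F1 = B" | "tgt F1bar = B" | "tgt G1 = W" | "tgt G1bar = W"

fun deg :: "gen \<Rightarrow> int" where
  "deg Xbar = - 1" | "deg Ybar = - 1"
| "deg F0 = 0" | "deg F0bar = 0" | "deg G0 = 0" | "deg G0bar = 0"
| "deg F1 = 1" | "deg F1bar = 1" | "deg G1 = 1" | "deg G1bar = 1"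

definition overlined :: "gen set" where
  "overlined = {Xbar, Ybar, F0bar, F1bar, G0bar, G1bar}"

text \<open>
  The word \<^term>\<open>[s, t]\<close> stands for \<open>s \<circ> t\<close>.  The empty word, viewed in \<open>Hom a a\<close>, is the identity of \<open>a\<close>.
\<close>

fun composable :: "col \<Rightarrow> col \<Rightarrow> gen list \<Rightarrow> bool" where
  "composable a b [] \<longleftrightarrow> a = b"
| "composable a b (s # w) \<longleftrightarrow> tgt s = b \<and> composable a (src s) w"

definition wdeg :: "gen list \<Rightarrow> int" where
  "wdeg w = sum_list (map deg w)"

definition wover :: "gen list \<Rightarrow> nat" where
  "wover w = length (filter (\<lambda>s. s \<in> overlined) w)"

fun dgen :: "gen \<Rightarrow> gen series" where
  "dgen Xbar = - word [Xbar, Xbar]"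
| "dgen Ybar = - word [Ybar, Ybar]"
| "dgen F0 = 0"
| "dgen G0 = 0"
| "dgen F1 = word [G0, F0] - word []"
| "dgen G1 = word [F0, G0] - word []"
| "dgen F0bar = word [F0, Xbar] - word [Ybar, F0] + word [F0bar, Xbar] - word [Ybar, F0bar]"
| "dgen G0bar = word [G0, Ybar] - word [Xbar, G0] + word [G0bar, Ybar] - word [Xbar, G0bar]"
| "dgen F1bar = - (word [Xbar, F1] + word [F1, Xbar]) + (word [G0bar, F0] + word [G0, F0bar])
     - (word [Xbar, F1bar] + word [F1bar, Xbar]) + word [G0bar, F0bar]"
| "dgen G1bar = - (word [Ybar, G1] + word [G1, Ybar]) + (word [F0bar, G0] + word [F0, G0bar])
     - (word [Ybar, G1bar] + word [G1bar, Ybar]) + word [F0bar, G0bar]"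

definition sgn_pow :: "int \<Rightarrow> 'a::ring_1" where
  "sgn_pow n = (if even n then 1 else - 1)"

fun dword :: "gen list \<Rightarrow> gen series" where
  "dword [] = 0"
| "dword (s # w) = dgen s * word w + sgn_pow (deg s) * word [s] * dword w"

text \<open>
  The extension of \<^const>\<open>dword\<close> to formal sums of words.  For every \<open>w\<close> only finitely many \<open>v\<close> satisfy
  \<^term>\<open>coeff (dword v) w \<noteq> 0\<close>, because passing from \<open>v\<close> to a word in its differential
  shortens \<open>v\<close> by at most one letter.
\<close>

definition D :: "gen series \<Rightarrow> gen series" where
  "D m = Series (\<lambda>w. \<Sum>v | coeff m v \<noteq> 0 \<and> coeff (dword v) w \<noteq> 0. coeff m v * coeff (dword v) w)"

section \<open>Completed free operads\<close>

text \<open>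
  The completion of the free operad on \<open>S\<close> for the filtration by the number of overlined letters:
  in each degree, formal sums of words with finitely many words for each number of overlined letters.
\<close>

definition cHom :: "gen set \<Rightarrow> col \<Rightarrow> col \<Rightarrow> int \<Rightarrow> gen series set" where
  "cHom S a b n = {m.
     (\<forall>w. coeff m w \<noteq> 0 \<longrightarrow> set w \<subseteq> S \<and> composable a b w \<and> wdeg w = n) \<and>
     (\<forall>i. finite {w. coeff m w \<noteq> 0 \<and> wover w = i})}"

definition cFil :: "gen set \<Rightarrow> nat \<Rightarrow> col \<Rightarrow> col \<Rightarrow> int \<Rightarrow> gen series set" where
  "cFil S p a b n = {m \<in> cHom S a b n. \<forall>w. coeff m w \<noteq> 0 \<longrightarrow> p \<le> wover w}"

definition completed_free :: "gen set \<Rightarrow> gen series operad" where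
  "completed_free S = \<lparr>Hom = cHom S, Fil = cFil S, one = (\<lambda>a. word []), cmp = (*), dif = D\<rparr>"

definition Dif_R_fake :: "gen series operad" where
  "Dif_R_fake = completed_free {Xbar, F0, G0, F1, G1}"

definition R_fake_tilde :: "gen series operad" where
  "R_fake_tilde = completed_free {Xbar, Ybar, F0, F1, G0, G1, F0bar, F1bar, G0bar, G1bar}"

text \<open>
  Both operads consist of series over the same alphabet, and each generator of the smaller one
  is sent to the generator of the same name, so the inclusion is the identity on series.
\<close>

definition iota_fake :: "col \<Rightarrow> col \<Rightarrow> int \<Rightarrow> gen series \<Rightarrow> gen series" where
  "iota_fake a b n m = m"

section \<open>Well-definedness\<close>

lemma UNIV_gen: "UNIV = {Xbar, Ybar, F0, F1, G0, G1, F0bar, F1bar, G0bar, G1bar}"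
  by (auto intro: gen.exhaust)

lemma finite_gen: "finite (UNIV :: gen set)"
  by (simp add: UNIV_gen)

lemma finite_words_le: "finite {w :: gen list. length w \<le> N}"
  using finite_lists_length_le[OF finite_gen, of N] by simp

lemma sgn_pow_nonzero: "coeff (sgn_pow n * u) w \<noteq> 0 \<longleftrightarrow> coeff u w \<noteq> 0"
  by (simp add: sgn_pow_def)

lemma dword_length: "coeff (dword v) w \<noteq> 0 \<Longrightarrow> length v \<le> length w + 1"
proof (induction v arbitrary: w)
  case (Cons s v)
  then consider "coeff (dgen s * word v) w \<noteq> 0"
    | "coeff (word [s] * dword v) w \<noteq> 0"
    using sgn_pow_nonzero[of "deg s" "word [s] * dword v" w]
    by (force simp: mult.assoc)
  then show ?case
  proof cases
    case 1
    then obtain w1 w2 where "w = w1 @ w2" "coeff (word v) w2 \<noteq> 0"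
      by (rule coeff_mult_nonzeroE)
    then show ?thesis by (auto simp: coeff_word split: if_splits)
  next
    case 2
    then obtain w1 w2 where w: "w = w1 @ w2" "coeff (word [s]) w1 \<noteq> 0" "coeff (dword v) w2 \<noteq> 0"
      by (rule coeff_mult_nonzeroE)
    then show ?thesis using Cons.IH[of w2] by (auto simp: coeff_word split: if_splits)
  qed
qed simp

lemma coeff_D_le:
  assumes "length w + 1 \<le> N"
  shows "coeff (D m) w = (\<Sum>v | length v \<le> N. coeff m v * coeff (dword v) w)"
proof -
  have "coeff (D m) w
      = (\<Sum>v | coeff m v \<noteq> 0 \<and> coeff (dword v) w \<noteq> 0. coeff m v * coeff (dword v) w)"
    by (simp add: D_def Series_inverse)
  also have "\<dots> = (\<Sum>v | length v \<le> N. coeff m v * coeff (dword v) w)"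
    using assms by (intro sum.mono_neutral_left finite_words_le) (auto dest: dword_length)
  finally show ?thesis .
qed

lemmas coeff_D = coeff_D_le[OF order_refl]

lemma D_add: "D (u + v) = D u + D v"
  by (rule series_eqI) (simp add: coeff_D algebra_simps sum.distrib)

lemma D_minus: "D (- u) = - D u"
  by (rule series_eqI) (simp add: coeff_D sum_negf)

lemma D_0 [simp]: "D 0 = 0"
  by (rule series_eqI) (simp add: coeff_D)

lemma D_diff: "D (u - v) = D u - D v"
  by (metis D_add D_minus diff_conv_add_uminus)

lemma D_word: "D (word v) = dword v"
proof (rule series_eqI)
  fix w :: "gen list"
  let ?N = "max (length v) (length w + 1)"
  have "coeff (D (word v)) w
      = (\<Sum>t | length t \<le> ?N. if t = v then coeff (dword v) w else 0)"
    unfolding coeff_D_le[of w ?N, simplified]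
    by (intro sum.cong) (auto simp: coeff_word)
  also have "\<dots> = coeff (dword v) w"
    by (subst sum.delta) (auto simp: finite_words_le)
  finally show "coeff (D (word v)) w = coeff (dword v) w" .
qed

text \<open>The sign involution, which is multiplication by the sign of \<open>n\<close> in degree \<open>n\<close>.\<close>

definition sig :: "gen series \<Rightarrow> gen series" where
  "sig m = Series (\<lambda>w. sgn_pow (wdeg w) * coeff m w)"

lemma coeff_sig: "coeff (sig m) w = sgn_pow (wdeg w) * coeff m w"
  by (simp add: sig_def Series_inverse)

lemma sig_homogeneous:
  assumes "\<And>w. coeff m w \<noteq> 0 \<Longrightarrow> wdeg w = n"
  shows "sig m = sgn_pow n * m"
  using assms by (intro series_eqI) (fastforce simp: coeff_sig sgn_pow_def)

lemma sig_add: "sig (u + v) = sig u + sig v"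
  by (rule series_eqI) (simp add: coeff_sig algebra_simps)

lemma sgn_pow_add: "sgn_pow (m + n) = sgn_pow m * sgn_pow n"
  by (auto simp: sgn_pow_def)

lemma sgn_pow_sq: "sgn_pow n * (sgn_pow n * v) = v"
  by (auto simp: sgn_pow_def)

lemma wdeg_append: "wdeg (v @ w) = wdeg v + wdeg w"
  by (simp add: wdeg_def)

lemma wover_append: "wover (v @ w) = wover v + wover w"
  by (simp add: wover_def)

lemma composable_append: "composable b c v \<Longrightarrow> composable a b w \<Longrightarrow> composable a c (v @ w)"
  by (induction v arbitrary: c) auto

lemma sig_word: "sig (word v) = sgn_pow (wdeg v) * word v"
  by (rule sig_homogeneous) (auto simp: coeff_word split: if_splits)

lemma dword_append: "dword (v @ w) = dword v * word w + sgn_pow (wdeg v) * word v * dword w"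
proof (induction v)
  case Nil
  then show ?case by (simp add: wdeg_def sgn_pow_def word_Nil)
next
  case (Cons s v)
  have "dword ((s # v) @ w) = dgen s * word (v @ w)
      + sgn_pow (deg s) * word [s] * (dword v * word w + sgn_pow (wdeg v) * word v * dword w)"
    using Cons by simp
  also have "\<dots> = dword (s # v) * word w
      + (sgn_pow (deg s) * sgn_pow (wdeg v)) * (word [s] * word v) * dword w"
    by (simp add: sgn_pow_def word_mult_word[symmetric] distrib_left distrib_right mult.assoc)
  also have "\<dots> = dword (s # v) * word w + sgn_pow (wdeg (s # v)) * word (s # v) * dword w"
    by (simp add: wdeg_def sgn_pow_add word_mult_word)
  finally show ?case .
qed

text \<open>Additive continuous statements about series need only be checked on words.\<close>

lemma coeff_of_int: "coeff (of_int c * u) w = c * coeff u w"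
proof (induction c rule: int_induct[of _ 0])
  case (step1 i) then show ?case by (simp add: algebra_simps)
next
  case (step2 i) then show ?case by (simp add: algebra_simps)
qed simp

definition trunc :: "nat \<Rightarrow> gen series \<Rightarrow> gen series" where
  "trunc N m = (\<Sum>v | length v \<le> N. of_int (coeff m v) * word v)"

lemma coeff_sum: "coeff (\<Sum>i\<in>I. f i) w = (\<Sum>i\<in>I. coeff (f i) w)"
  by (induction I rule: infinite_finite_induct) auto

lemma coeff_trunc: "coeff (trunc N m) w = (if length w \<le> N then coeff m w else 0)"
proof -
  have "coeff (trunc N m) w = (\<Sum>v | length v \<le> N. if v = w then coeff m w else 0)"
    unfolding trunc_def coeff_sum by (intro sum.cong) (auto simp: coeff_of_int coeff_word)
  then show ?thesis by (simp add: finite_words_le)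
qed

lemma additive_word_zero:
  fixes f :: "gen series \<Rightarrow> int"
  assumes add: "\<And>u v. f (u + v) = f u + f v"
    and word: "\<And>v. f (word v) = 0"
    and local: "\<And>u v. (\<And>t. length t \<le> N \<Longrightarrow> coeff u t = coeff v t) \<Longrightarrow> f u = f v"
  shows "f m = 0"
proof -
  have f0: "f 0 = 0" using add[of 0 0] by simp
  have "f (of_int c * word v) = 0" for c v
  proof (induction c rule: int_induct[of _ 0])
    case (step1 i) then show ?case by (simp add: algebra_simps add word)
  next
    case (step2 i)
    then show ?case using add[of "of_int (i - 1) * word v" "word v"] by (simp add: algebra_simps word)
  qed (simp add: f0)
  then have "f (trunc N m) = 0"
    unfolding trunc_def
  proof -
    assume *: "\<And>c v. f (of_int c * word v) = 0"
    have "f (\<Sum>v\<in>A. of_int (coeff m v) * word v) = 0" for A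
      by (induction A rule: infinite_finite_induct) (simp_all add: f0 add *)
    then show "f (\<Sum>v | length v \<le> N. of_int (coeff m v) * word v) = 0" .
  qed
  moreover have "f (trunc N m) = f m"
    by (rule local) (simp add: coeff_trunc)
  ultimately show ?thesis by simp
qed

lemma D_local:
  assumes "\<And>t. length t \<le> length w + 1 \<Longrightarrow> coeff u t = coeff v t"
  shows "coeff (D u) w = coeff (D v) w"
  unfolding coeff_D using assms by (intro sum.cong) auto

lemma mult_local:
  assumes "\<And>t. length t \<le> length w \<Longrightarrow> coeff u t = coeff u' t"
    and "\<And>t. length t \<le> length w \<Longrightarrow> coeff v t = coeff v' t"
  shows "coeff (u * v) w = coeff (u' * v') w"
  unfolding coeff_mult using assms by (intro sum.cong) auto

lemma D_mult: "D (u * v) = D u * v + sig u * D v"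
proof (rule series_eqI)
  fix w
  let ?L = "\<lambda>u v. coeff (D (u * v) - (D u * v + sig u * D v)) w"
  have loc: "?L u v = ?L u' v'"
    if "\<And>t. length t \<le> length w + 1 \<Longrightarrow> coeff u t = coeff u' t"
       "\<And>t. length t \<le> length w + 1 \<Longrightarrow> coeff v t = coeff v' t" for u u' v v'
  proof -
    have "coeff (D (u * v)) w = coeff (D (u' * v')) w"
      using that by (intro D_local mult_local) auto
    moreover have "coeff (D u * v) w = coeff (D u' * v') w"
      using that by (intro D_local mult_local) auto
    moreover have "coeff (sig u * D v) w = coeff (sig u' * D v') w"
      using that by (intro mult_local D_local) (auto simp: coeff_sig)
    ultimately show ?thesis by simp
  qed
  have ww: "?L (word s) (word t) = 0" for s t
    by (simp add: word_mult_word D_word dword_append sig_word)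
  have uw: "?L u (word t) = 0" for u :: "gen series" and t
  proof (rule additive_word_zero[where f = "\<lambda>u. ?L u (word t)" and N = "length w + 1"])
    fix u v :: "gen series"
    show "?L (u + v) (word t) = ?L u (word t) + ?L v (word t)"
      by (simp add: algebra_simps D_add sig_add)
  next
    fix s show "?L (word s) (word t) = 0" by (rule ww)
  next
    fix u v :: "gen series" assume "\<And>t. length t \<le> length w + 1 \<Longrightarrow> coeff u t = coeff v t"
    then show "?L u (word t) = ?L v (word t)" by (intro loc) auto
  qed
  have "?L u v = 0"
  proof (rule additive_word_zero[where f = "?L u" and N = "length w + 1"])
    fix v v' :: "gen series"
    show "?L u (v + v') = ?L u v + ?L u v'"
      by (simp add: algebra_simps D_add)
  next
    fix t show "?L u (word t) = 0" by (rule uw)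
  next
    fix v v' :: "gen series" assume "\<And>t. length t \<le> length w + 1 \<Longrightarrow> coeff v t = coeff v' t"
    then show "?L u v = ?L u v'" by (intro loc) auto
  qed
  then show "coeff (D (u * v)) w = coeff (D u * v + sig u * D v) w" by simp
qed

lemma dgen_support:
  "coeff (dgen s) w \<noteq> 0 \<Longrightarrow> composable (src s) (tgt s) w \<and> wdeg w = deg s - 1 \<and>
     (if s \<in> overlined then 1 else 0) \<le> wover w"
  by (cases s) (auto simp: coeff_word wdeg_def wover_def overlined_def split: if_splits)

lemma D_dgen: "D (dgen s) = 0"
proof -
  have D2: "D (word [s, t]) = dgen s * word [t] + sgn_pow (deg s) * word [s] * dgen t" for s t
    by (simp add: D_word word_Nil)
  have D0: "D (word []) = 0"
    by (simp add: D_word)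
  show ?thesis
    by (cases s) (simp_all add: D_add D_diff D_minus D2 D0 sgn_pow_def word_mult_word algebra_simps)
qed

lemma sig_dgen: "sig (dgen s) = - (sgn_pow (deg s) * dgen s)"
proof -
  have "sig (dgen s) = sgn_pow (deg s - 1) * dgen s"
    by (rule sig_homogeneous) (use dgen_support in blast)
  then show ?thesis by (simp add: sgn_pow_def)
qed

lemma D_dword: "D (dword v) = 0"
proof (induction v)
  case (Cons s v)
  have scale: "D (sgn_pow n * u) = sgn_pow n * D u" for n u
    by (simp add: sgn_pow_def D_minus)
  have "D (dword (s # v)) = D (dgen s) * word v + sig (dgen s) * dword v
      + sgn_pow (deg s) * (dgen s * dword v + sig (word [s]) * D (dword v))"
    by (simp add: D_add D_mult[of "dgen s"] D_mult[of "word [s]"] scale mult.assoc D_word word_Nil)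
  also have "\<dots> = 0"
    by (simp add: D_dgen Cons sig_dgen mult.assoc)
  finally show ?case .
qed simp

lemma D_D: "D (D m) = 0"
proof (rule series_eqI)
  fix w
  have "coeff (D (D m)) w = 0"
  proof (rule additive_word_zero[where f = "\<lambda>m. coeff (D (D m)) w" and N = "length w + 2"])
    fix u v :: "gen series"
    show "coeff (D (D (u + v))) w = coeff (D (D u)) w + coeff (D (D v)) w" by (simp add: D_add)
    show "coeff (D (D u)) w = coeff (D (D v)) w"
      if "\<And>t. length t \<le> length w + 2 \<Longrightarrow> coeff u t = coeff v t"
      using that by (intro D_local) auto
  qed (simp add: D_word D_dword)
  then show "coeff (D (D m)) w = coeff 0 w" by simp
qed

lemma cFilI:
  assumes "\<And>w. coeff m w \<noteq> 0 \<Longrightarrow> set w \<subseteq> S \<and> composable a b w \<and> wdeg w = n \<and> p \<le> wover w"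
    and "\<And>i. finite {w. coeff m w \<noteq> 0 \<and> wover w = i}"
  shows "m \<in> cFil S p a b n"
  using assms by (auto simp: cFil_def cHom_def)

lemma cFilD:
  assumes "m \<in> cFil S p a b n"
  shows "coeff m w \<noteq> 0 \<Longrightarrow> set w \<subseteq> S \<and> composable a b w \<and> wdeg w = n \<and> p \<le> wover w"
    and "finite {w. coeff m w \<noteq> 0 \<and> wover w = i}"
  using assms by (auto simp: cFil_def cHom_def)

lemma cFil_0: "cFil S 0 a b n = cHom S a b n"
  by (auto simp: cFil_def)

lemma finite_le_wover:
  assumes "m \<in> cFil S p a b n"
  shows "finite {w. coeff m w \<noteq> 0 \<and> wover w \<le> i}"
proof -
  have "{w. coeff m w \<noteq> 0 \<and> wover w \<le> i} = (\<Union>j\<le>i. {w. coeff m w \<noteq> 0 \<and> wover w = j})"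
    by auto
  then show ?thesis using cFilD(2)[OF assms] by simp
qed

lemma cFil_subgroup: "is_subgroup (cFil S p a b n)"
  unfolding is_subgroup_def
proof (intro conjI ballI)
  show "0 \<in> cFil S p a b n" by (rule cFilI) auto
next
  fix u v assume u: "u \<in> cFil S p a b n" and v: "v \<in> cFil S p a b n"
  show "u + v \<in> cFil S p a b n"
  proof (rule cFilI)
    fix w assume "coeff (u + v) w \<noteq> 0"
    then have "coeff u w \<noteq> 0 \<or> coeff v w \<noteq> 0" by auto
    then show "set w \<subseteq> S \<and> composable a b w \<and> wdeg w = n \<and> p \<le> wover w"
      using cFilD(1)[OF u] cFilD(1)[OF v] by blast
  next
    fix i
    show "finite {w. coeff (u + v) w \<noteq> 0 \<and> wover w = i}"
      by (rule finite_subset[OF _ finite_UnI[OF cFilD(2)[OF u, of i] cFilD(2)[OF v, of i]]]) auto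
  qed
next
  fix u assume u: "u \<in> cFil S p a b n"
  show "- u \<in> cFil S p a b n"
    using cFilD[OF u] by (intro cFilI) auto
qed

lemma cFil_mult:
  assumes u: "u \<in> cFil S p b c m" and v: "v \<in> cFil S q a b n"
  shows "u * v \<in> cFil S (p + q) a c (m + n)"
proof (rule cFilI)
  fix w assume "coeff (u * v) w \<noteq> 0"
  then obtain w1 w2 where w: "w = w1 @ w2" "coeff u w1 \<noteq> 0" "coeff v w2 \<noteq> 0"
    by (rule coeff_mult_nonzeroE)
  with cFilD(1)[OF u w(2)] cFilD(1)[OF v w(3)]
  show "set w \<subseteq> S \<and> composable a c w \<and> wdeg w = m + n \<and> p + q \<le> wover w"
    by (auto simp: wdeg_append wover_append composable_append)
next
  fix i
  have "{w. coeff (u * v) w \<noteq> 0 \<and> wover w = i}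
      \<subseteq> (\<lambda>(w1, w2). w1 @ w2) ` ({w. coeff u w \<noteq> 0 \<and> wover w \<le> i} \<times> {w. coeff v w \<noteq> 0 \<and> wover w \<le> i})"
    by (force elim!: coeff_mult_nonzeroE simp: wover_append)
  then show "finite {w. coeff (u * v) w \<noteq> 0 \<and> wover w = i}"
    using finite_le_wover[OF u] finite_le_wover[OF v] finite_subset by blast
qed

definition d_closed :: "gen set \<Rightarrow> bool" where
  "d_closed S \<longleftrightarrow> (\<forall>s\<in>S. \<forall>w. coeff (dgen s) w \<noteq> 0 \<longrightarrow> set w \<subseteq> S)"

lemma word_cFil:
  assumes "set v \<subseteq> S" "composable a b v"
  shows "word v \<in> cFil S (wover v) a b (wdeg v)"
  using assms by (intro cFilI) (auto simp: coeff_word split: if_splits)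

lemma finite_support_dgen: "finite {w. coeff (dgen s) w \<noteq> 0}"
proof -
  have "{w. coeff (dgen s) w \<noteq> 0} \<subseteq> {w. length w \<le> 2}"
    by (cases s) (auto simp: coeff_word split: if_splits)
  then show ?thesis using finite_words_le finite_subset by blast
qed

lemma dgen_cFil:
  assumes "d_closed S" "s \<in> S"
  shows "dgen s \<in> cFil S (wover [s]) (src s) (tgt s) (wdeg [s] - 1)"
proof (rule cFilI)
  show "finite {w. coeff (dgen s) w \<noteq> 0 \<and> wover w = i}" for i
    by (rule finite_subset[OF _ finite_support_dgen]) auto
  show "set w \<subseteq> S \<and> composable (src s) (tgt s) w \<and> wdeg w = wdeg [s] - 1 \<and> wover [s] \<le> wover w"
    if "coeff (dgen s) w \<noteq> 0" for w
    using dgen_support[OF that] assms that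
    by (auto simp: d_closed_def wdeg_def wover_def split: if_splits)
qed

lemma sgn_pow_cFil: "u \<in> cFil S p a b n \<Longrightarrow> sgn_pow k * u \<in> cFil S p a b n"
  using cFil_subgroup[of S p a b n] by (auto simp: sgn_pow_def is_subgroup_def)

lemma dword_cFil:
  assumes "d_closed S" "set v \<subseteq> S" "composable a b v"
  shows "dword v \<in> cFil S (wover v) a b (wdeg v - 1)"
  using assms(2,3)
proof (induction v arbitrary: b)
  case Nil
  then show ?case using cFil_subgroup by (auto simp: is_subgroup_def)
next
  case (Cons s v)
  have b: "b = tgt s" using Cons.prems by simp
  have eqs: "wover [s] + wover v = wover (s # v)" "wdeg [s] + wdeg v = wdeg (s # v)"
    using wover_append[of "[s]" v] wdeg_append[of "[s]" v] by simp_all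
  have 1: "dgen s * word v \<in> cFil S (wover [s] + wover v) a b (wdeg [s] - 1 + wdeg v)"
    unfolding b using Cons.prems assms(1) by (intro cFil_mult[OF dgen_cFil word_cFil]) auto
  have 2: "word [s] * dword v \<in> cFil S (wover [s] + wover v) a b (wdeg [s] + (wdeg v - 1))"
    unfolding b using Cons by (intro cFil_mult[OF word_cFil]) auto
  have "dgen s * word v + sgn_pow (deg s) * (word [s] * dword v) \<in> cFil S (wover (s # v)) a b (wdeg (s # v) - 1)"
    using 1 sgn_pow_cFil[OF 2, of "deg s"] cFil_subgroup[of S "wover (s # v)" a b "wdeg (s # v) - 1"]
    by (simp add: is_subgroup_def eqs[symmetric] algebra_simps)
  then show ?case by (simp add: mult.assoc)
qed

lemma finite_support_dword: "finite {w. coeff (dword v) w \<noteq> 0}"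
proof (induction v)
  case (Cons s v)
  have fm: "finite {w. coeff (x * y) w \<noteq> 0}"
    if "finite {w. coeff x w \<noteq> 0}" "finite {w. coeff y w \<noteq> 0}" for x y :: "gen series"
  proof (rule finite_subset)
    show "{w. coeff (x * y) w \<noteq> 0}
        \<subseteq> (\<lambda>(w1, w2). w1 @ w2) ` ({w. coeff x w \<noteq> 0} \<times> {w. coeff y w \<noteq> 0})"
      by (force elim!: coeff_mult_nonzeroE)
  qed (use that in simp)
  have w: "finite {w. coeff (word t) w \<noteq> 0}" for t :: "gen list"
    by (simp add: coeff_word)
  have "{w. coeff (dword (s # v)) w \<noteq> 0}
      \<subseteq> {w. coeff (dgen s * word v) w \<noteq> 0} \<union> {w. coeff (word [s] * dword v) w \<noteq> 0}"
    using sgn_pow_nonzero[of "deg s" "word [s] * dword v"] by (auto simp: mult.assoc)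
  then show ?case
    using fm[OF finite_support_dgen w] fm[OF w Cons] finite_subset by blast
qed simp

lemma D_cFil:
  assumes S: "d_closed S" and m: "m \<in> cFil S p a b n"
  shows "D m \<in> cFil S p a b (n - 1)"
proof (rule cFilI)
  have ex: "\<exists>v. coeff m v \<noteq> 0 \<and> coeff (dword v) w \<noteq> 0" if "coeff (D m) w \<noteq> 0" for w
  proof -
    obtain v where "coeff m v * coeff (dword v) w \<noteq> 0"
      using \<open>coeff (D m) w \<noteq> 0\<close> unfolding coeff_D by (meson sum.neutral)
    then show ?thesis by auto
  qed
  have dw: "set w \<subseteq> S \<and> composable a b w \<and> wdeg w = n - 1 \<and> wover v \<le> wover w"
    if "coeff m v \<noteq> 0" "coeff (dword v) w \<noteq> 0" for v w
    using cFilD(1)[OF m that(1)] cFilD(1)[OF dword_cFil[OF S, of v a b] that(2)] by auto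
  show "set w \<subseteq> S \<and> composable a b w \<and> wdeg w = n - 1 \<and> p \<le> wover w"
    if "coeff (D m) w \<noteq> 0" for w
    using ex[OF that] dw cFilD(1)[OF m] by (meson order_trans)
  fix i
  have "{w. coeff (D m) w \<noteq> 0 \<and> wover w = i}
      \<subseteq> (\<Union>v\<in>{v. coeff m v \<noteq> 0 \<and> wover v \<le> i}. {w. coeff (dword v) w \<noteq> 0})"
    using ex dw by blast
  moreover have "finite (\<Union>v\<in>{v. coeff m v \<noteq> 0 \<and> wover v \<le> i}. {w. coeff (dword v) w \<noteq> 0})"
    using finite_le_wover[OF m] finite_support_dword by (rule finite_UN_I)
  ultimately show "finite {w. coeff (D m) w \<noteq> 0 \<and> wover w = i}"
    by (rule finite_subset)
qed

theorem df_operad_completed_free: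
  assumes S: "d_closed S"
  shows "df_operad (completed_free S)"
proof -
  have D_Hom: "u \<in> cHom S a b n \<Longrightarrow> D u \<in> cHom S a b (n - 1)" for u a b n
    using D_cFil[OF S, of u 0] by (simp add: cFil_0)
  have mult_Hom: "u \<in> cHom S b c m \<Longrightarrow> v \<in> cHom S a b n \<Longrightarrow> u * v \<in> cHom S a c (m + n)"
    for u v a b c m n
    using cFil_mult[of u S 0 b c m v 0 a n] by (simp add: cFil_0)
  have sig_Hom: "sig u * t = sgn_act m (u * t)" if "u \<in> cHom S b c m" for u t b c m
    using sig_homogeneous[of u m] that by (auto simp: cHom_def sgn_pow_def sgn_act_def)
  have one_Hom: "1 \<in> cHom S a a 0" for a
    using word_cFil[of "[]" S a a] by (simp add: wover_def wdeg_def cFil_0 word_Nil)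
  show ?thesis
    by unfold_locales
      (use cFil_subgroup[of S 0] in \<open>auto simp: completed_free_def cFil_0 cFil_subgroup one_Hom word_Nil
        mult.assoc distrib_left distrib_right D_add D_D D_mult sig_Hom
        intro: D_Hom mult_Hom D_cFil[OF S] cFil_mult\<close>, auto simp: cFil_def)
qed

lemma generator_Hom:
  assumes "s \<in> S"
  shows "word [s] \<in> Hom (completed_free S) (src s) (tgt s) (deg s)"
    and "dif (completed_free S) (word [s]) = dgen s"
  using word_cFil[of "[s]" S "src s" "tgt s"] assms
  by (simp_all add: completed_free_def cFil_def wdeg_def D_word word_Nil)

lemma d_closed_small: "d_closed {Xbar, F0, G0, F1, G1}"
  by (auto simp: d_closed_def coeff_word split: if_splits)

lemma d_closed_all: "d_closed {Xbar, Ybar, F0, F1, G0, G1, F0bar, F1bar, G0bar, G1bar}"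
  by (simp add: d_closed_def flip: UNIV_gen)

theorem df_operad_Dif_R_fake: "df_operad Dif_R_fake"
  unfolding Dif_R_fake_def by (rule df_operad_completed_free[OF d_closed_small])

theorem df_operad_R_fake_tilde: "df_operad R_fake_tilde"
  unfolding R_fake_tilde_def by (rule df_operad_completed_free[OF d_closed_all])

theorem df_operad_hom_iota_fake: "df_operad_hom Dif_R_fake R_fake_tilde iota_fake"
proof -
  interpret s: df_operad Dif_R_fake by (rule df_operad_Dif_R_fake)
  interpret t: df_operad R_fake_tilde by (rule df_operad_R_fake_tilde)
  show ?thesis
  proof
    fix u a b n p
    show "iota_fake a b n u \<in> Hom R_fake_tilde a b n" if "u \<in> Hom Dif_R_fake a b n"
      using that unfolding iota_fake_def Dif_R_fake_def R_fake_tilde_def completed_free_def cHom_def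
      by fastforce
    show "iota_fake a b n u \<in> Fil R_fake_tilde p a b n" if "u \<in> Fil Dif_R_fake p a b n"
      using that unfolding iota_fake_def Dif_R_fake_def R_fake_tilde_def completed_free_def cFil_def cHom_def
      by fastforce
  qed (simp_all add: iota_fake_def Dif_R_fake_def R_fake_tilde_def completed_free_def)
qed

end

theory Submission
  imports Defs
begin

text \<open>
  Identify the two colours and set \<open>f\<^sub>0 = g\<^sub>0 = 1\<close>: the images of \<open>f\<^sub>1\<close> and \<open>g\<^sub>1\<close> become cycles,
  so modulo words with two letters \<open>\<bar>x\<close> the differential of the quotient of \<open>Dif * R\<^sub>f\<^sub>a\<^sub>k\<^sub>e\<close> vanishes.
  Given a retraction, let \<open>Y, F, G\<close> be the images of \<open>\<bar>y, \<bar>f\<^sub>0, \<bar>g\<^sub>0\<close> in this quotient.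
  To first order in \<open>\<bar>x\<close>, the formulas for \<open>d\<bar>f\<^sub>0\<close>, \<open>d\<bar>f\<^sub>1\<close> and \<open>d\<bar>g\<^sub>1\<close> give
  \<open>Y = \<bar>x\<close>, \<open>F + G = \<bar>x f\<^sub>1 + f\<^sub>1 \<bar>x\<close> and \<open>F + G = Y g\<^sub>1 + g\<^sub>1 Y\<close>.
  The word \<open>g\<^sub>1 \<bar>x\<close> has coefficient 0 in the second right-hand side and 1 in the third.
\<close>

section \<open>Setting the degree-zero generators to the identity\<close>

text \<open>Putting f_0 = g_0 = 1 deletes letters, and the result need not be composable: f_1 g_0
  g_1 becomes f_1 g_1. Colours are therefore forgotten from here on.\<close>

definition strip :: "gen list \<Rightarrow> gen list" where
  "strip w = filter (\<lambda>s. s \<noteq> F0 \<and> s \<noteq> G0) w"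

lemma strip_simps [simp]:
  "strip [] = []"
  "strip (s # w) = (if s = F0 \<or> s = G0 then strip w else s # strip w)"
  by (auto simp: strip_def)

lemma strip_append: "strip (v @ w) = strip v @ strip w"
  by (simp add: strip_def)

text \<open>The deleted letters are not overlined, so the filtration survives in the
  quotient.\<close>

lemma wover_strip: "wover (strip w) = wover w"
  by (induction w) (auto simp: wover_def overlined_def)

text \<open>Any number of f_0 and g_0 can be inserted into a word, so fibres of \<open>strip\<close>
  are infinite. Each fibre has constant weight, however, so this condition, which the completion
  guarantees, leaves finitely many terms over each word.\<close>

definition finite_weights :: "gen series \<Rightarrow> bool" where
  "finite_weights m \<longleftrightarrow> (\<forall>i. finite {w. coeff m w \<noteq> 0 \<and> wover w \<le> i})"

lemma finite_weights_cFil: "m \<in> cFil S p a b n \<Longrightarrow> finite_weights m"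
  using finite_le_wover by (auto simp: finite_weights_def)

lemma finite_weights_finite: "finite {w. coeff m w \<noteq> 0} \<Longrightarrow> finite_weights m"
  unfolding finite_weights_def by (auto elim: rev_finite_subset)

text \<open>The value is meaningful only under \<^const>\<open>finite_weights\<close>, which makes all these sums finite.\<close>

definition collapse :: "gen series \<Rightarrow> gen series" where
  "collapse m = Series (\<lambda>t. \<Sum>v | coeff m v \<noteq> 0 \<and> strip v = t. coeff m v)"

lemma finite_fibre:
  assumes "finite_weights m"
  shows "finite {v. coeff m v \<noteq> 0 \<and> strip v = t}"
proof -
  have "finite {v. coeff m v \<noteq> 0 \<and> wover v \<le> wover t}"
    using assms by (auto simp: finite_weights_def)
  then show ?thesis
    by (rule rev_finite_subset) (auto simp: wover_strip)
qed

text \<open>Trading the support of \<open>m\<close> for a larger finite set allows several series to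
  be summed over one index set.\<close>

lemma coeff_collapse:
  assumes "finite A" "{v. coeff m v \<noteq> 0 \<and> strip v = t} \<subseteq> A"
  shows "coeff (collapse m) t = (\<Sum>v | v \<in> A \<and> strip v = t. coeff m v)"
proof -
  have "coeff (collapse m) t = (\<Sum>v | coeff m v \<noteq> 0 \<and> strip v = t. coeff m v)"
    by (simp add: collapse_def Series_inverse)
  also have "\<dots> = (\<Sum>v | v \<in> A \<and> strip v = t. coeff m v)"
    using assms by (intro sum.mono_neutral_left) auto
  finally show ?thesis .
qed

lemma coeff_collapse_nonzeroE:
  assumes "coeff (collapse m) t \<noteq> 0"
  obtains v where "coeff m v \<noteq> 0" "strip v = t"
  using assms unfolding collapse_def Series_inverse[OF UNIV_I]
  by (metis (mono_tags, lifting) mem_Collect_eq sum.neutral)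

section \<open>Closure of the finiteness condition under ring operations\<close>

lemma finite_weights_add:
  assumes "finite_weights u" "finite_weights v"
  shows "finite_weights (u + v)"
  unfolding finite_weights_def
proof
  fix i
  have "finite ({w. coeff u w \<noteq> 0 \<and> wover w \<le> i} \<union> {w. coeff v w \<noteq> 0 \<and> wover w \<le> i})"
    using assms by (simp add: finite_weights_def)
  then show "finite {w. coeff (u + v) w \<noteq> 0 \<and> wover w \<le> i}"
    by (rule rev_finite_subset) auto
qed

lemma finite_weights_minus: "finite_weights u \<Longrightarrow> finite_weights (- u)"
  by (simp add: finite_weights_def)

lemma finite_weights_diff: "finite_weights u \<Longrightarrow> finite_weights v \<Longrightarrow> finite_weights (u - v)"
  using finite_weights_add[of u "- v"] finite_weights_minus[of v] by simp

lemma finite_weights_mult: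
  assumes "finite_weights u" "finite_weights v"
  shows "finite_weights (u * v)"
  unfolding finite_weights_def
proof
  fix i
  let ?U = "{w. coeff u w \<noteq> 0 \<and> wover w \<le> i}" and ?V = "{w. coeff v w \<noteq> 0 \<and> wover w \<le> i}"
  have "finite ((\<lambda>(w1, w2). w1 @ w2) ` (?U \<times> ?V))"
    using assms by (simp add: finite_weights_def)
  then show "finite {w. coeff (u * v) w \<noteq> 0 \<and> wover w \<le> i}"
    by (rule rev_finite_subset) (force elim!: coeff_mult_nonzeroE simp: wover_append)
qed

lemma finite_weights_word: "finite_weights (word w)"
  by (rule finite_weights_finite) (simp add: coeff_word)

section \<open>Collapse as a ring homomorphism\<close>

lemma collapse_add:
  assumes "finite_weights u" "finite_weights v"
  shows "collapse (u + v) = collapse u + collapse v"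
proof (rule series_eqI)
  fix t
  let ?A = "{w. coeff u w \<noteq> 0 \<and> strip w = t} \<union> {w. coeff v w \<noteq> 0 \<and> strip w = t}"
  have A: "finite ?A" using assms by (simp add: finite_fibre)
  have "coeff (collapse (u + v)) t = (\<Sum>w | w \<in> ?A \<and> strip w = t. coeff (u + v) w)"
    by (rule coeff_collapse[OF A]) auto
  also have "\<dots> = (\<Sum>w | w \<in> ?A \<and> strip w = t. coeff u w) + (\<Sum>w | w \<in> ?A \<and> strip w = t. coeff v w)"
    by (simp add: sum.distrib)
  also have "\<dots> = coeff (collapse u) t + coeff (collapse v) t"
    using coeff_collapse[OF A, of u t] coeff_collapse[OF A, of v t] by auto
  finally show "coeff (collapse (u + v)) t = coeff (collapse u + collapse v) t" by simp
qed

lemma collapse_minus: "collapse (- u) = - collapse u"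
  by (rule series_eqI) (simp add: collapse_def Series_inverse sum_negf)

lemma collapse_diff:
  "finite_weights u \<Longrightarrow> finite_weights v \<Longrightarrow> collapse (u - v) = collapse u - collapse v"
  using collapse_add[of u "- v"] by (simp add: finite_weights_minus collapse_minus)

lemma collapse_0: "collapse 0 = 0"
  by (rule series_eqI) (simp add: collapse_def Series_inverse)

lemma collapse_word: "collapse (word w) = word (strip w)"
proof (rule series_eqI)
  fix t
  have "{v. coeff (word w) v \<noteq> 0 \<and> strip v = t} \<subseteq> {w}" by (auto simp: coeff_word split: if_splits)
  from coeff_collapse[OF _ this]
  have "coeff (collapse (word w)) t = (\<Sum>v | v = w \<and> strip v = t. coeff (word w) v)" by simp
  also have "{v. v = w \<and> strip v = t} = (if strip w = t then {w} else {})" by auto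
  finally show "coeff (collapse (word w)) t = coeff (word (strip w)) t"
    by (auto simp: coeff_word split: if_splits)
qed

text \<open>Indexing by pairs of factors instead of cut positions prepares the regrouping in
  \<open>collapse_mult\<close>.\<close>

lemma coeff_mult_splits:
  "coeff (u * v) w = (\<Sum>(s, t) | s @ t = w. coeff u s * coeff v t)"
  unfolding coeff_mult
  by (rule sum.reindex_bij_witness[of _ "\<lambda>(s, t). length s" "\<lambda>k. (take k w, drop k w)"]) auto

lemma finite_splits: "finite {(s, t). s @ t = w}"
proof (rule finite_subset)
  show "{(s, t). s @ t = w} \<subseteq> (\<lambda>k. (take k w, drop k w)) ` {..length w}"
  proof
    fix z assume "z \<in> {(s, t). s @ t = w}"
    then have "z = (take (length (fst z)) w, drop (length (fst z)) w)" "length (fst z) \<le> length w"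
      by auto
    then show "z \<in> (\<lambda>k. (take k w, drop k w)) ` {..length w}" by blast
  qed
qed simp

text \<open>Deleting letters is a monoid homomorphism on words. Both sides are the same finite sum
  over pairs (p, q), grouped once by p @ q and once by the pair of stripped words.\<close>

lemma collapse_mult:
  assumes u: "finite_weights u" and v: "finite_weights v"
  shows "collapse (u * v) = collapse u * collapse v"
proof (rule series_eqI)
  fix t
  \<comment> \<open>Weight is additive and unchanged by \<open>strip\<close>, so both factors of a
    word over \<open>t\<close> have weight at most that of \<open>t\<close>; this makes
    \<open>P\<close> finite.\<close>
  define U where "U = {s. coeff u s \<noteq> 0 \<and> wover s \<le> wover t}"
  define V where "V = {s. coeff v s \<noteq> 0 \<and> wover s \<le> wover t}"
  define P where "P = {(p, q) \<in> U \<times> V. strip p @ strip q = t}"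
  define T where "T = (\<lambda>(p, q). p @ q) ` P"
  let ?h = "\<lambda>(p, q). coeff u p * coeff v q"
  have fin: "finite U" "finite V"
    using u v by (simp_all add: U_def V_def finite_weights_def)
  have P: "finite P"
    by (rule finite_subset[of _ "U \<times> V"]) (use fin in \<open>auto simp: P_def\<close>)
  have T: "finite T" using P by (simp add: T_def)
  have strip_T: "strip w = t" if "w \<in> T" for w
    using that by (auto simp: T_def P_def strip_append)
  have in_P: "(p, q) \<in> P" if "coeff u p \<noteq> 0" "coeff v q \<noteq> 0" "strip (p @ q) = t" for p q
  proof -
    have "wover t = wover p + wover q"
      using that(3) wover_strip[of "p @ q"] by (simp add: wover_append)
    then show ?thesis using that by (simp add: P_def U_def V_def strip_append)
  qed
  have "coeff (collapse (u * v)) t = (\<Sum>w | w \<in> T \<and> strip w = t. coeff (u * v) w)"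
  proof (rule coeff_collapse[OF T], rule subsetI)
    fix w assume "w \<in> {w. coeff (u * v) w \<noteq> 0 \<and> strip w = t}"
    then have "coeff (u * v) w \<noteq> 0" and w: "strip w = t" by auto
    then obtain p q where "w = p @ q" "coeff u p \<noteq> 0" "coeff v q \<noteq> 0"
      by (auto elim: coeff_mult_nonzeroE)
    then show "w \<in> T" using in_P[of p q] w by (force simp: T_def)
  qed
  also have "{w. w \<in> T \<and> strip w = t} = T" using strip_T by auto
  also have "(\<Sum>w\<in>T. coeff (u * v) w) = (\<Sum>w\<in>T. sum ?h {x \<in> P. (\<lambda>(p, q). p @ q) x = w})"
  proof (rule sum.cong[OF refl])
    fix w assume "w \<in> T"
    then show "coeff (u * v) w = sum ?h {x \<in> P. (\<lambda>(p, q). p @ q) x = w}"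
      unfolding coeff_mult_splits using in_P strip_T
      by (intro sum.mono_neutral_right finite_splits) auto
  qed
  also have "\<dots> = sum ?h P"
    by (rule sum.group[OF P T]) (simp add: T_def)
  \<comment> \<open>The same pairs are now grouped by their stripped components, which are the
    splits of \<open>t\<close>.\<close>
  also have "\<dots> = (\<Sum>z | fst z @ snd z = t. sum ?h {x \<in> P. map_prod strip strip x = z})"
  proof (rule sum.group[OF P, symmetric])
    show "finite {z. fst z @ snd z = t}"
      by (rule rev_finite_subset[OF finite_splits[of t]]) auto
  qed (auto simp: P_def)
  also have "\<dots> = (\<Sum>(p, q) | p @ q = t. coeff (collapse u) p * coeff (collapse v) q)"
  proof (rule sum.cong)
    show "{z. fst z @ snd z = t} = {(p, q). p @ q = t}" by auto
    fix z assume "z \<in> {(p, q). p @ q = t}"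
    then obtain p q where z: "z = (p, q)" "p @ q = t" by auto
    then have wt: "wover t = wover p + wover q" by (auto simp: wover_append)
    have cu: "coeff (collapse u) p = (\<Sum>s | s \<in> U \<and> strip s = p. coeff u s)"
      by (rule coeff_collapse[OF fin(1)]) (use wt wover_strip in \<open>auto simp: U_def\<close>)
    have cv: "coeff (collapse v) q = (\<Sum>s | s \<in> V \<and> strip s = q. coeff v s)"
      by (rule coeff_collapse[OF fin(2)]) (use wt wover_strip in \<open>auto simp: V_def\<close>)
    have "{x \<in> P. map_prod strip strip x = z} = {s. s \<in> U \<and> strip s = p} \<times> {s. s \<in> V \<and> strip s = q}"
      using z by (auto simp: P_def)
    then show "sum ?h {x \<in> P. map_prod strip strip x = z}
        = (case z of (p, q) \<Rightarrow> coeff (collapse u) p * coeff (collapse v) q)"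
      by (simp add: z cu cv sum_product sum.cartesian_product)
  qed
  also have "\<dots> = coeff (collapse u * collapse v) t" by (simp add: coeff_mult_splits)
  finally show "coeff (collapse (u * v)) t = coeff (collapse u * collapse v) t" .
qed

section \<open>Series of weight at least a given number\<close>

text \<open>This is the filtration step for collapsed series, where colours are no longer
  available.\<close>

definition weight_ge :: "nat \<Rightarrow> gen series \<Rightarrow> bool" where
  "weight_ge p m \<longleftrightarrow> (\<forall>t. coeff m t \<noteq> 0 \<longrightarrow> p \<le> wover t)"

lemma weight_ge_0: "weight_ge 0 m"
  by (simp add: weight_ge_def)

lemma weight_ge_add: "weight_ge p u \<Longrightarrow> weight_ge p v \<Longrightarrow> weight_ge p (u + v)"
  by (force simp: weight_ge_def)

lemma weight_ge_mult: "weight_ge p u \<Longrightarrow> weight_ge q v \<Longrightarrow> weight_ge (p + q) (u * v)"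
  unfolding weight_ge_def by (fastforce elim!: coeff_mult_nonzeroE simp: wover_append)

lemma weight_ge_collapse: "m \<in> cFil S p a b n \<Longrightarrow> weight_ge p (collapse m)"
  unfolding weight_ge_def by (metis cFilD(1) coeff_collapse_nonzeroE wover_strip)

abbreviation small_gens :: "gen set" where
  "small_gens \<equiv> {Xbar, F0, G0, F1, G1}"

text \<open>Both d f_1 and d g_1 collapse to 1 - 1, and d f_0 = d g_0 = 0. Only the square of xbar
  remains.\<close>

lemma weight_ge_collapse_dgen:
  assumes "s \<in> small_gens"
  shows "weight_ge 2 (collapse (dgen s))"
  using assms
  by (auto simp: weight_ge_def collapse_minus collapse_diff collapse_word finite_weights_word
      collapse_0 coeff_word wover_def overlined_def
      split: if_splits)

lemma finite_weights_dgen: "finite_weights (dgen s)"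
  by (rule finite_weights_finite[OF finite_support_dgen])

lemma finite_weights_dword: "finite_weights (dword v)"
  by (rule finite_weights_finite[OF finite_support_dword])

text \<open>By the Leibniz rule and multiplicativity of \<open>collapse\<close>, the bound passes
  from letters to words.\<close>

lemma weight_ge_collapse_dword:
  "set v \<subseteq> small_gens \<Longrightarrow> weight_ge 2 (collapse (dword v))"
proof (induction v)
  case Nil
  then show ?case by (simp add: weight_ge_def collapse_0)
next
  case (Cons s v)
  let ?u = "sgn_pow (deg s) * word [s] :: gen series"
  have u: "finite_weights ?u"
    by (simp add: sgn_pow_def finite_weights_word finite_weights_minus)
  have "collapse (dword (s # v)) = collapse (dgen s) * collapse (word v) + collapse ?u * collapse (dword v)"
    using u by (simp add: collapse_add collapse_mult finite_weights_mult finite_weights_dgen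
        finite_weights_dword finite_weights_word)
  moreover have "weight_ge 2 (collapse (dgen s) * collapse (word v))"
    using weight_ge_mult[OF weight_ge_collapse_dgen weight_ge_0, of s] Cons.prems by simp
  moreover have "weight_ge 2 (collapse ?u * collapse (dword v))"
    using weight_ge_mult[OF weight_ge_0 Cons.IH] Cons.prems by (metis add_0 insert_subset list.simps(15))
  ultimately show ?case by (simp add: weight_ge_add)
qed

text \<open>An element of the completion may be an infinite sum, so finite additivity does not
  reduce it to words. Each coefficient of the result nevertheless depends on finitely many
  words.\<close>

lemma weight_ge_collapse_D:
  assumes m: "m \<in> cHom small_gens a b n"
  shows "weight_ge 2 (collapse (D m))"
proof -
  have m': "m \<in> cFil small_gens 0 a b n" using m by (simp add: cFil_0)
  have "coeff (collapse (D m)) t = 0" if t: "wover t < 2" for t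
  proof -
    \<comment> \<open>The differential does not lower weight, so only words in \<open>V\<close>
      contribute over \<open>t\<close>. The set \<open>A\<close> contains every word of their
      differentials, so the two sums can be exchanged.\<close>
    define V where "V = {v. coeff m v \<noteq> 0 \<and> wover v \<le> wover t}"
    define A where "A = (\<Union>v\<in>V. {w. coeff (dword v) w \<noteq> 0})"
    have V: "finite V" unfolding V_def by (rule finite_le_wover[OF m'])
    have A: "finite A" unfolding A_def using V finite_support_dword by (rule finite_UN_I)
    have in_V: "v \<in> V" if "coeff m v \<noteq> 0" "coeff (dword v) w \<noteq> 0" "strip w = t" for v w
    proof -
      have "set v \<subseteq> small_gens" "composable a b v" using cFilD(1)[OF m' that(1)] by auto
      then have "wover v \<le> wover w"
        using cFilD(1)[OF dword_cFil[OF d_closed_small] that(2)] by blast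
      then show ?thesis using that by (auto simp: V_def wover_strip)
    qed
    have cD: "coeff (D m) w = (\<Sum>v\<in>V. coeff m v * coeff (dword v) w)" if "strip w = t" for w
    proof -
      have "coeff (D m) w
          = (\<Sum>v | coeff m v \<noteq> 0 \<and> coeff (dword v) w \<noteq> 0. coeff m v * coeff (dword v) w)"
        by (simp add: D_def Series_inverse)
      also have "\<dots> = (\<Sum>v\<in>V. coeff m v * coeff (dword v) w)"
        using V in_V that by (intro sum.mono_neutral_left) auto
      finally show ?thesis .
    qed
    have "coeff (collapse (D m)) t = (\<Sum>w | w \<in> A \<and> strip w = t. coeff (D m) w)"
    proof (rule coeff_collapse[OF A], rule subsetI)
      fix w assume "w \<in> {w. coeff (D m) w \<noteq> 0 \<and> strip w = t}"
      then obtain v where "v \<in> V" "coeff m v * coeff (dword v) w \<noteq> 0"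
        using cD[of w] by (auto elim: sum.not_neutral_contains_not_neutral)
      then show "w \<in> A" by (auto simp: A_def)
    qed
    also have "\<dots> = (\<Sum>w | w \<in> A \<and> strip w = t. \<Sum>v\<in>V. coeff m v * coeff (dword v) w)"
      by (intro sum.cong) (auto simp: cD)
    also have "\<dots> = (\<Sum>v\<in>V. \<Sum>w | w \<in> A \<and> strip w = t. coeff m v * coeff (dword v) w)"
      by (rule sum.swap)
    also have "\<dots> = (\<Sum>v\<in>V. coeff m v * coeff (collapse (dword v)) t)"
    proof (rule sum.cong[OF refl])
      fix v assume "v \<in> V"
      then have "coeff (collapse (dword v)) t = (\<Sum>w | w \<in> A \<and> strip w = t. coeff (dword v) w)"
        by (intro coeff_collapse[OF A]) (auto simp: A_def)
      then show "(\<Sum>w | w \<in> A \<and> strip w = t. coeff m v * coeff (dword v) w)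
          = coeff m v * coeff (collapse (dword v)) t"
        by (simp add: sum_distrib_left)
    qed
    also have "\<dots> = 0"
    proof (rule sum.neutral, rule ballI)
      fix v assume "v \<in> V"
      then have "set v \<subseteq> small_gens" using cFilD(1)[OF m', of v] by (auto simp: V_def)
      then show "coeff m v * coeff (collapse (dword v)) t = 0"
        using weight_ge_collapse_dword[of v] t by (force simp: weight_ge_def)
    qed
    finally show ?thesis .
  qed
  then show ?thesis by (force simp: weight_ge_def)
qed

section \<open>The obstruction\<close>

context df_operad_hom
begin

lemma hom_zero: "r a b n 0 = 0"
  using hom_add[of 0 a b n 0] source.Hom_subgroup[of a b n] by (simp add: is_subgroup_def)

lemma hom_minus: "u \<in> Hom P a b n \<Longrightarrow> r a b n (- u) = - r a b n u"
  using hom_add[of u a b n "- u"] source.Hom_subgroup[of a b n]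
  by (simp add: is_subgroup_def hom_zero eq_neg_iff_add_eq_0 add.commute)

lemma hom_diff:
  assumes "u \<in> Hom P a b n" "v \<in> Hom P a b n"
  shows "r a b n (u - v) = r a b n u - r a b n v"
  using hom_add[of u a b n "- v"] hom_minus[OF assms(2)] assms source.Hom_subgroup[of a b n]
  by (simp add: is_subgroup_def)

end

theorem theorem16:
  shows "\<not> (\<exists>r_fake :: col \<Rightarrow> col \<Rightarrow> int \<Rightarrow> gen series \<Rightarrow> gen series.
    df_operad_hom R_fake_tilde Dif_R_fake r_fake \<and>
    (\<forall>a b n. \<forall>u \<in> Hom Dif_R_fake a b n. r_fake a b n (iota_fake a b n u) = u))"
proof
  assume "\<exists>r_fake :: col \<Rightarrow> col \<Rightarrow> int \<Rightarrow> gen series \<Rightarrow> gen series.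
    df_operad_hom R_fake_tilde Dif_R_fake r_fake \<and>
    (\<forall>a b n. \<forall>u \<in> Hom Dif_R_fake a b n. r_fake a b n (iota_fake a b n u) = u)"
  then obtain r :: "col \<Rightarrow> col \<Rightarrow> int \<Rightarrow> gen series \<Rightarrow> gen series"
    where hom: "df_operad_hom R_fake_tilde Dif_R_fake r"
      and retr: "\<And>a b n u. u \<in> Hom Dif_R_fake a b n \<Longrightarrow> r a b n u = u"
    by (auto simp: iota_fake_def)
  interpret df_operad_hom R_fake_tilde Dif_R_fake r by (rule hom)
  have word_Hom: "word v \<in> Hom R_fake_tilde a b n" if "composable a b v" "wdeg v = n" for a b n v
    using word_cFil[of v UNIV a b] that
    by (auto simp: R_fake_tilde_def completed_free_def cFil_def UNIV_gen[symmetric])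
  have gen_Hom: "word [s] \<in> Hom R_fake_tilde (src s) (tgt s) (deg s)" for s
    by (rule word_Hom) (simp_all add: wdeg_def)
  \<comment> \<open>\<open>R s\<close> is the image of the generator \<open>s\<close> under the
    retraction, and \<open>C s\<close> is its class in the quotient.\<close>
  define R where "R s = r (src s) (tgt s) (deg s) (word [s])" for s
  define C where "C s = collapse (R s)" for s
  have R_Fil: "R s \<in> cFil small_gens (wover [s]) (src s) (tgt s) (deg s)" for s
  proof -
    have "word [s] \<in> Fil R_fake_tilde (wover [s]) (src s) (tgt s) (deg s)"
      using word_cFil[of "[s]" UNIV "src s" "tgt s"]
      by (simp add: R_fake_tilde_def completed_free_def wdeg_def UNIV_gen[symmetric])
    from hom_Fil[OF this] show ?thesis
      by (simp add: R_def Dif_R_fake_def completed_free_def)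
  qed
  have R_Hom: "R s \<in> cHom small_gens (src s) (tgt s) (deg s)" for s
    using R_Fil[of s] by (simp add: cFil_def)
  note fin = finite_weights_cFil[OF R_Fil]
  \<comment> \<open>The retraction property enters here; the other facts about \<open>R\<close> come
    from \<open>r\<close> being a filtered chain morphism.\<close>
  have R_small: "R s = word [s]" if "s \<in> small_gens" for s
    unfolding R_def using generator_Hom(1)[OF that] by (intro retr) (simp add: Dif_R_fake_def)
  have C_ge: "weight_ge (wover [s]) (C s)" for s
    unfolding C_def by (rule weight_ge_collapse[OF R_Fil])
  have r_word2: "r a b n (word [s, t]) = R s * R t"
    if "a = src t" "src s = tgt t" "b = tgt s" "n = deg s + deg t" for a b n s t
    using hom_cmp[OF gen_Hom[of s] gen_Hom[of t, folded that(2)]] that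
    by (simp add: R_def R_fake_tilde_def Dif_R_fake_def completed_free_def word_mult_word wdeg_def)
  have D_R: "D (R s) = r (src s) (tgt s) (deg s - 1) (dgen s)" for s
    using hom_dif[OF gen_Hom[of s]]
    by (simp add: R_def R_fake_tilde_def Dif_R_fake_def completed_free_def D_word wdeg_def word_Nil)
  have C_D: "coeff (collapse (D (R s))) t = 0" if "wover t < 2" for s t
    using weight_ge_collapse_D[OF R_Hom[of s]] that by (force simp: weight_ge_def)
  have Hom_minus: "- u \<in> Hom R_fake_tilde a b n" if "u \<in> Hom R_fake_tilde a b n" for u a b n
    using source.Hom_subgroup[of a b n] that by (simp add: is_subgroup_def)
  have Hom_add: "u + v \<in> Hom R_fake_tilde a b n" and Hom_diff: "u - v \<in> Hom R_fake_tilde a b n"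
    if "u \<in> Hom R_fake_tilde a b n" "v \<in> Hom R_fake_tilde a b n" for u v a b n
    using source.Hom_subgroup[of a b n] that unfolding is_subgroup_def
    by (auto simp: diff_conv_add_uminus simp del: add_uminus_conv_diff)
  note expand = hom_add hom_diff hom_minus Hom_add Hom_diff Hom_minus word_Hom r_word2 wdeg_def
  have C_gens: "C Xbar = word [Xbar]" "C F0 = 1" "C G0 = 1" "C F1 = word [F1]" "C G1 = word [G1]"
    by (simp_all add: C_def R_small collapse_word word_Nil)
  note collapse_expand = collapse_add collapse_diff collapse_minus collapse_mult fin
    finite_weights_add finite_weights_diff finite_weights_minus finite_weights_mult C_def[symmetric]
  have dF0: "collapse (D (R F0bar)) = C Xbar - C Ybar + C F0bar * C Xbar - C Ybar * C F0bar"
    by (simp add: D_R expand collapse_expand) (simp add: C_gens)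
  have dF1: "collapse (D (R F1bar)) = - (C Xbar * C F1 + C F1 * C Xbar) + (C G0bar + C F0bar)
      - (C Xbar * C F1bar + C F1bar * C Xbar) + C G0bar * C F0bar"
    by (simp add: D_R expand collapse_expand) (simp add: C_gens)
  have dG1: "collapse (D (R G1bar)) = - (C Ybar * C G1 + C G1 * C Ybar) + (C F0bar + C G0bar)
      - (C Ybar * C G1bar + C G1bar * C Ybar) + C F0bar * C G0bar"
    by (simp add: D_R expand collapse_expand) (simp add: C_gens)
  \<comment> \<open>Preservation of the filtration gives each factor weight at least 1, so quadratic
    terms vanish to first order.\<close>
  have prod_0: "coeff (C s * C s') t = 0" if "s \<in> overlined" "s' \<in> overlined" "wover t < 2" for s s' t
    using weight_ge_mult[OF C_ge C_ge, of s s'] that by (force simp: weight_ge_def wover_def)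
  have "coeff (C Ybar) [Xbar] = 1"
    using C_D[of "[Xbar]" F0bar] prod_0[of _ _ "[Xbar]"]
    by (simp add: dF0 overlined_def wover_def) (simp add: C_gens coeff_word)
  \<comment> \<open>The word g_1 xbar is not composable; it can appear only after deletion, for
    instance from g_1 f_0 xbar.\<close>
  moreover have "coeff (C G0bar) [G1, Xbar] + coeff (C F0bar) [G1, Xbar] = 0"
    using C_D[of "[G1, Xbar]" F1bar] prod_0[of _ _ "[G1, Xbar]"]
    by (simp add: dF1 overlined_def wover_def) (simp add: C_gens word_mult_word coeff_word)
  \<comment> \<open>No split of g_1 xbar ends in the factor g_1, so Y g_1 contributes 0; in g_1 Y
    the cut after g_1 leaves the coefficient of xbar in Y.\<close>
  moreover have "coeff (C F0bar) [G1, Xbar] + coeff (C G0bar) [G1, Xbar] = coeff (C Ybar) [Xbar]"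
    using C_D[of "[G1, Xbar]" G1bar] prod_0[of _ _ "[G1, Xbar]"]
    by (simp add: dG1 overlined_def wover_def)
      (simp add: C_gens coeff_mult coeff_word atMost_Suc)
  ultimately show False by simp
qed

end
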